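(* Let $L\subset\mathbb{Z}^m$ be a non-zero lattice with $L\cap\mathbb{N}^m=\{\mathbf 0\}$. Suppose that $I_L$ has a binomial generating set $\{B_1,\ldots,B_t\}$ such that every $B_i$ is a difference of two squarefree monomials. If $I_L$ has a unique minimal system of binomial generators, then $\mathrm{bar}(I_L)=\mu(I_L)$.
   Context: $K$ is a field, $I_L=(\mathbf x^{\mathbf u_+}-\mathbf x^{\mathbf u_-}:\mathbf u\in L)\subset K[x_1,\ldots,x_m]$, where $\mathbf u_\pm$ are the positive/negative parts of $\mathbf u$ and $\mathbf x^{\mathbf v}=x_1^{v_1}\cdots x_m^{v_m}$. $\mu(I_L)$ is the common cardinality of minimal binomial generating sets of $I_L$. $\mathrm{bar}(I_L)$ is the least $s$ such that there exist binomials $B_1,\ldots,B_s\in I_L$ with $\mathrm{rad}(I_L)=\mathrm{rad}(B_1,\ldots,B_s)$. *)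

theory Defs
  imports "HOL-Library.Poly_Mapping"
begin

text \<open>Polynomial ring K[x_i : i in 'n] with 'n a finite index type (m = CARD('n)):
  polynomials are finitely supported maps from exponent vectors to coefficients.\<close>
type_synonym ('n, 'k) mpoly = "('n \<Rightarrow>\<^sub>0 nat) \<Rightarrow>\<^sub>0 'k"

definition monom :: "('n::finite \<Rightarrow> nat) \<Rightarrow> ('n, 'k::field) mpoly" where
  "monom v = Poly_Mapping.single (Abs_poly_mapping v) 1"

definition pos_part :: "('n \<Rightarrow> int) \<Rightarrow> ('n \<Rightarrow> nat)" where
  "pos_part u = (\<lambda>i. nat (u i))"

definition neg_part :: "('n \<Rightarrow> int) \<Rightarrow> ('n \<Rightarrow> nat)" where
  "neg_part u = (\<lambda>i. nat (- u i))"

definition is_lattice :: "('n \<Rightarrow> int) set \<Rightarrow> bool" where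
  "is_lattice L \<longleftrightarrow> (\<lambda>i. 0) \<in> L \<and> (\<forall>u\<in>L. \<forall>v\<in>L. (\<lambda>i. u i + v i) \<in> L) \<and> (\<forall>u\<in>L. (\<lambda>i. - u i) \<in> L)"

definition is_ideal :: "'a::comm_ring_1 set \<Rightarrow> bool" where
  "is_ideal I \<longleftrightarrow> 0 \<in> I \<and> (\<forall>x\<in>I. \<forall>y\<in>I. x + y \<in> I) \<and> (\<forall>r. \<forall>x\<in>I. r * x \<in> I)"

definition gen_ideal :: "'a::comm_ring_1 set \<Rightarrow> 'a set" where
  "gen_ideal S = \<Inter>{I. is_ideal I \<and> S \<subseteq> I}"

definition rad :: "'a::comm_ring_1 set \<Rightarrow> 'a set" where
  "rad I = {f. \<exists>n. f ^ n \<in> I}"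

definition lattice_ideal :: "('n::finite \<Rightarrow> int) set \<Rightarrow> ('n, 'k::field) mpoly set" where
  "lattice_ideal L = gen_ideal {monom (pos_part u) - monom (neg_part u) | u. u \<in> L}"

definition is_binomial :: "('n::finite, 'k::field) mpoly \<Rightarrow> bool" where
  "is_binomial f \<longleftrightarrow> (\<exists>u v. f = monom u - monom v)"

definition squarefree_exp :: "('n \<Rightarrow> nat) \<Rightarrow> bool" where
  "squarefree_exp u \<longleftrightarrow> (\<forall>i. u i \<le> 1)"

definition minimal_binomial_gen_set :: "('n::finite, 'k::field) mpoly set \<Rightarrow> ('n, 'k) mpoly set \<Rightarrow> bool" where
  "minimal_binomial_gen_set I S \<longleftrightarrow>
     (\<forall>f\<in>S. is_binomial f) \<and> gen_ideal S = I \<and> (\<forall>T. T \<subset> S \<longrightarrow> gen_ideal T \<noteq> I)"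

definition mu :: "('n::finite, 'k::field) mpoly set \<Rightarrow> nat" where
  "mu I = (SOME n. \<exists>S. minimal_binomial_gen_set I S \<and> finite S \<and> card S = n)"

text \<open>Uniqueness of the minimal system of binomial generators (up to sign,
  the only possible ambiguity of a difference binomial).\<close>
definition unique_minimal_binomial_gens :: "('n::finite, 'k::field) mpoly set \<Rightarrow> bool" where
  "unique_minimal_binomial_gens I \<longleftrightarrow>
     (\<forall>S T. minimal_binomial_gen_set I S \<and> minimal_binomial_gen_set I T \<longrightarrow>
        (\<lambda>f. {f, - f}) ` S = (\<lambda>f. {f, - f}) ` T)"

definition bar :: "('n::finite, 'k::field) mpoly set \<Rightarrow> nat" where
  "bar I = (LEAST s. \<exists>B :: nat \<Rightarrow> ('n, 'k) mpoly.
              (\<forall>i<s. is_binomial (B i) \<and> B i \<in> I) \<and> rad I = rad (gen_ideal (B ` {..<s})))"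

end

theory Submission
  imports Defs
begin

text \<open>Uniqueness forces the exponents occurring in the minimal generators to be pairwise
  incomparable: if \<open>p' + w = p\<close>, then \<open>x^p - x^q\<close> could be traded for \<open>x^(q' + w) - x^q\<close>.
  Given binomials \<open>C\<close> in the ideal with the right radical, setting the variables outside the support
  of such an exponent \<open>p\<close> to 0 and the others to 1 does not kill the generator containing \<open>p\<close>, so
  some term of some \<open>C\<close> is supported inside \<open>p\<close>. That term is divisible by the monomial of a
  generator, which by squarefreeness and incomparability must be \<open>p\<close> itself; so the term has
  the same support as \<open>p\<close>. Since squarefree exponents are determined by their supports, the
  \<open>C\<close> have at least as many terms as the generators, and each binomial has two.\<close>

section \<open>Ideals\<close>

lemma is_ideal_gen_ideal: "is_ideal (gen_ideal S)"
  unfolding gen_ideal_def is_ideal_def by blast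

lemma gen_ideal_superset: "S \<subseteq> gen_ideal S"
  unfolding gen_ideal_def by blast

lemma gen_ideal_least: "is_ideal I \<Longrightarrow> S \<subseteq> I \<Longrightarrow> gen_ideal S \<subseteq> I"
  unfolding gen_ideal_def by blast

lemma gen_ideal_mono: "S \<subseteq> T \<Longrightarrow> gen_ideal S \<subseteq> gen_ideal T"
  by (meson gen_ideal_least gen_ideal_superset is_ideal_gen_ideal order_trans)

lemma is_ideal_add: "is_ideal I \<Longrightarrow> x \<in> I \<Longrightarrow> y \<in> I \<Longrightarrow> x + y \<in> I"
  unfolding is_ideal_def by blast

lemma is_ideal_mult: "is_ideal I \<Longrightarrow> x \<in> I \<Longrightarrow> r * x \<in> I"
  unfolding is_ideal_def by blast

lemma is_ideal_uminus_iff: "is_ideal I \<Longrightarrow> - x \<in> I \<longleftrightarrow> x \<in> I"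
  using is_ideal_mult[of I _ "- 1"] by fastforce

lemma is_ideal_diff: "is_ideal I \<Longrightarrow> x \<in> I \<Longrightarrow> y \<in> I \<Longrightarrow> x - y \<in> I"
  using is_ideal_add[of I x "- y"] by (simp add: is_ideal_uminus_iff)

text \<open>Redundant elements are discarded until none is left. Staying inside \<open>G\<close> is
  the point: the surviving generators inherit what is known of \<open>G\<close>.\<close>

lemma minimal_binomial_gen_subset_exists:
  fixes G :: "('n::finite, 'k::field) mpoly set"
  assumes "finite G" "\<forall>f\<in>G. is_binomial f" "gen_ideal G = I"
  shows "\<exists>S\<subseteq>G. minimal_binomial_gen_set I S"
  using assms
proof (induction G rule: finite_psubset_induct)
  case (psubset G)
  show ?case
  proof (cases "\<exists>T. T \<subset> G \<and> gen_ideal T = I")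
    case True
    then obtain T where T: "T \<subset> G" "gen_ideal T = I" by blast
    then have "\<exists>S\<subseteq>T. minimal_binomial_gen_set I S"
      using psubset.IH[of T] psubset.prems by blast
    then show ?thesis using T(1) by blast
  next
    case False
    then have "minimal_binomial_gen_set I G"
      using psubset.prems unfolding minimal_binomial_gen_set_def by blast
    then show ?thesis by blast
  qed
qed

section \<open>Monomials and binomials\<close>

abbreviation keys :: "('a \<Rightarrow>\<^sub>0 'b::zero) \<Rightarrow> 'a set" where
  "keys \<equiv> Poly_Mapping.keys"

abbreviation lookup :: "('a \<Rightarrow>\<^sub>0 'b::zero) \<Rightarrow> 'a \<Rightarrow> 'b" where
  "lookup \<equiv> Poly_Mapping.lookup"

abbreviation mon :: "('n \<Rightarrow>\<^sub>0 nat) \<Rightarrow> ('n, 'k::field) mpoly" where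
  "mon p \<equiv> Poly_Mapping.single p 1"

lemma mon_add: "mon (p + q) = (mon p * mon q :: ('n, 'k::field) mpoly)"
  by (simp add: mult_single)

lemma is_binomial_iff_mon:
  fixes f :: "('n::finite, 'k::field) mpoly"
  shows "is_binomial f \<longleftrightarrow> (\<exists>p q. f = mon p - mon q)"
  unfolding is_binomial_def monom_def by (metis lookup_inverse)

lemma keys_mon_diff:
  assumes "p \<noteq> q"
  shows "keys (mon p - mon q :: ('n, 'k::field) mpoly) = {p, q}"
  using assms by (auto simp: in_keys_iff lookup_minus lookup_single when_def split: if_splits)

lemma keys_mon_diff_subset: "keys (mon p - mon q :: ('n, 'k::field) mpoly) \<subseteq> {p, q}"
  by (cases "p = q") (auto simp: keys_mon_diff)

lemma card_keys_binomial_le: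
  assumes "is_binomial f"
  shows "card (keys f) \<le> 2"
proof -
  obtain p q where "f = mon p - mon q" using assms by (auto simp: is_binomial_iff_mon)
  then have "card (keys f) \<le> card {p, q}" using keys_mon_diff_subset by (intro card_mono) auto
  also have "\<dots> \<le> 2" by (simp add: card_insert_if)
  finally show ?thesis .
qed

lemma binomial_keyE:
  assumes "is_binomial f" "p \<in> keys f"
  obtains q where "f = mon p - mon q \<or> f = - (mon p - mon q)" "p \<noteq> q" "keys f = {p, q}"
proof -
  obtain a b where ab: "f = mon a - mon b" using assms by (auto simp: is_binomial_iff_mon)
  then have ne: "a \<noteq> b" using assms(2) by auto
  then have k: "keys f = {a, b}" using ab keys_mon_diff by blast
  show thesis
  proof (cases "p = a")
    case True
    then show ?thesis using that[of b] ab ne k by simp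
  next
    case False
    then show ?thesis using that[of a] ab ne k assms(2) by auto
  qed
qed

section \<open>Linear functionals given by weights on exponents\<close>

text \<open>The linear functional sending the monomial with exponent \<open>t\<close> to
  \<open>w t\<close>. Such functionals serve as tests for ideal membership.\<close>

definition weighted_sum :: "('e \<Rightarrow> 'k::field) \<Rightarrow> ('e \<Rightarrow>\<^sub>0 'k) \<Rightarrow> 'k" where
  "weighted_sum w f = (\<Sum>t\<in>keys f. lookup f t * w t)"

lemma weighted_sum_superset:
  assumes "finite A" "keys f \<subseteq> A"
  shows "weighted_sum w f = (\<Sum>t\<in>A. lookup f t * w t)"
  unfolding weighted_sum_def
  by (rule sum.mono_neutral_left) (use assms in \<open>auto simp: in_keys_iff\<close>)

lemma weighted_sum_0 [simp]: "weighted_sum w 0 = 0"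
  by (simp add: weighted_sum_def)

lemma weighted_sum_add: "weighted_sum w (f + g) = weighted_sum w f + weighted_sum w g"
  using keys_add[of f g]
  by (simp add: weighted_sum_superset[of "keys f \<union> keys g"] lookup_add algebra_simps sum.distrib)

lemma weighted_sum_diff:
  "weighted_sum w (f - g :: 'e \<Rightarrow>\<^sub>0 'k::field) = weighted_sum w f - weighted_sum w g"
  using weighted_sum_add[of w "f - g" g] by simp

lemma weighted_sum_single [simp]: "weighted_sum w (Poly_Mapping.single t k) = k * w t"
  by (cases "k = 0") (simp_all add: weighted_sum_def)

lemma poly_mapping_add_single_induct [case_names zero single add]:
  assumes "P 0" "\<And>t k. P (Poly_Mapping.single t k)" "\<And>f g. P f \<Longrightarrow> P g \<Longrightarrow> P (f + g)"
  shows "P (f :: 'a \<Rightarrow>\<^sub>0 'b::comm_monoid_add)"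
proof -
  have "P (\<Sum>t\<in>A. Poly_Mapping.single t (lookup f t))" if "finite A" for A
    using that by induction (use assms in auto)
  moreover have "(\<Sum>t\<in>keys f. Poly_Mapping.single t (lookup f t)) = f"
    by (rule poly_mapping_eqI) (simp add: lookup_sum lookup_single when_def in_keys_iff)
  ultimately show ?thesis using finite_keys by metis
qed

lemma weighted_sum_single_mult:
  fixes f :: "('n, 'k::field) mpoly"
  shows "weighted_sum w (Poly_Mapping.single s k * f) = k * weighted_sum (\<lambda>t. w (s + t)) f"
  by (induction f rule: poly_mapping_add_single_induct)
    (simp_all add: mult_single algebra_simps weighted_sum_add)

text \<open>A common kernel of functionals is a subspace. Multiplying by a monomial amounts to
  shifting the weight, so closure under shifts turns this subspace into an ideal.\<close>

lemma is_ideal_weighted_sum_kernel: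
  fixes \<Omega> :: "(('n \<Rightarrow>\<^sub>0 nat) \<Rightarrow> 'k::field) set"
  assumes shift: "\<And>w s. w \<in> \<Omega> \<Longrightarrow> (\<lambda>t. w (s + t)) \<in> \<Omega>"
  shows "is_ideal {f :: ('n, 'k) mpoly. \<forall>w\<in>\<Omega>. weighted_sum w f = 0}"
proof -
  have "weighted_sum w (r * f) = 0"
    if "\<forall>w\<in>\<Omega>. weighted_sum w f = 0" "w \<in> \<Omega>" for r f :: "('n, 'k) mpoly" and w
    using that(2)
  proof (induction r arbitrary: w rule: poly_mapping_add_single_induct)
    case zero
    then show ?case by simp
  next
    case (single t k)
    then show ?case using that(1) shift by (simp add: weighted_sum_single_mult)
  next
    case (add g h)
    then show ?case by (simp add: algebra_simps weighted_sum_add)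
  qed
  then show ?thesis unfolding is_ideal_def by (auto simp: weighted_sum_add)
qed

lemma weighted_sum_gen_ideal_eq_0:
  fixes S :: "('n, 'k::field) mpoly set"
  assumes "f \<in> gen_ideal S" "w \<in> \<Omega>"
    and "\<And>w s. w \<in> \<Omega> \<Longrightarrow> (\<lambda>t. w (s + t)) \<in> \<Omega>"
    and "\<And>w g. w \<in> \<Omega> \<Longrightarrow> g \<in> S \<Longrightarrow> weighted_sum w g = 0"
  shows "weighted_sum w f = 0"
  using gen_ideal_least[OF is_ideal_weighted_sum_kernel[of \<Omega>], of S] assms by blast

lemma weighted_sum_indicator: "weighted_sum (\<lambda>t. of_bool (t = c)) f = lookup f c"
proof -
  have "weighted_sum (\<lambda>t. of_bool (t = c)) f
    = (\<Sum>t\<in>insert c (keys f). lookup f t * of_bool (t = c))"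
    by (rule weighted_sum_superset) auto
  also have "\<dots> = (\<Sum>t\<in>{c}. lookup f t * of_bool (t = c))"
    by (rule sum.mono_neutral_right) auto
  finally show ?thesis by simp
qed

text \<open>The weights vanishing on all multiples of exponents of \<open>S\<close> are closed under
  shifts and kill \<open>S\<close>. If \<open>c\<close> were no such multiple, reading off the
  coefficient at \<open>c\<close> would be one of them, yet it does not kill
  \<open>f\<close>.\<close>

lemma key_of_gen_ideal_divisible:
  fixes S :: "('n, 'k::field) mpoly set"
  assumes "f \<in> gen_ideal S" "c \<in> keys f"
  shows "\<exists>p\<in>\<Union>(keys ` S). \<exists>r. c = p + r"
proof (rule ccontr)
  assume c: "\<not> ?thesis"
  define \<Omega> where
    "\<Omega> = {w :: ('n \<Rightarrow>\<^sub>0 nat) \<Rightarrow> 'k. \<forall>p\<in>\<Union>(keys ` S). \<forall>r. w (p + r) = 0}"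
  have "weighted_sum (\<lambda>t. of_bool (t = c)) f = 0"
  proof (rule weighted_sum_gen_ideal_eq_0[OF assms(1), of _ \<Omega>])
    show "(\<lambda>t. of_bool (t = c)) \<in> \<Omega>" using c by (auto simp: \<Omega>_def)
    show "(\<lambda>t. w (s + t)) \<in> \<Omega>" if "w \<in> \<Omega>" for w s
      using that unfolding \<Omega>_def by (auto simp: add.left_commute[of s])
    show "weighted_sum w g = 0" if w: "w \<in> \<Omega>" and g: "g \<in> S" for w g
    proof -
      have "w t = 0" if "t \<in> keys g" for t
      proof -
        have "w (t + 0) = 0" using w g that unfolding \<Omega>_def by blast
        then show ?thesis by simp
      qed
      then show ?thesis by (simp add: weighted_sum_def)
    qed
  qed
  then show False using assms(2) by (simp add: weighted_sum_indicator in_keys_iff)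
qed

text \<open>The lattice ideal is homogeneous for the grading by cosets of \<open>L\<close>: weights
  constant on cosets kill its generators. The indicator of the coset of \<open>p\<close> takes the
  value 1 at \<open>p\<close>, hence also at \<open>q\<close>.\<close>

lemma lattice_ideal_mon_diff:
  fixes L :: "('n::finite \<Rightarrow> int) set"
  assumes L: "is_lattice L"
    and f: "mon p - mon q \<in> (lattice_ideal L :: ('n, 'k::field) mpoly set)"
  shows "(\<lambda>i. int (lookup p i) - int (lookup q i)) \<in> L"
proof -
  define d where "d s t = (\<lambda>i. int (lookup s i) - int (lookup t i))" for s t :: "'n \<Rightarrow>\<^sub>0 nat"
  define \<Omega> where "\<Omega> = {w :: ('n \<Rightarrow>\<^sub>0 nat) \<Rightarrow> 'k. \<forall>s t. d s t \<in> L \<longrightarrow> w s = w t}"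
  have add: "(\<lambda>i. u i + v i) \<in> L" if "u \<in> L" "v \<in> L" for u v
    using L that unfolding is_lattice_def by blast
  have neg: "(\<lambda>i. - u i) \<in> L" if "u \<in> L" for u
    using L that unfolding is_lattice_def by blast
  have trans: "d r t \<in> L" if "d r s \<in> L" "d s t \<in> L" for r s t
    using add[OF that] by (simp add: d_def)
  have sym: "d t s \<in> L" if "d s t \<in> L" for s t
    using neg[OF that] by (simp add: d_def)
  have "weighted_sum (\<lambda>t. of_bool (d p t \<in> L)) (mon p - mon q :: ('n, 'k) mpoly) = 0"
  proof (rule weighted_sum_gen_ideal_eq_0[OF f[unfolded lattice_ideal_def], of _ \<Omega>])
    show "(\<lambda>t. of_bool (d p t \<in> L)) \<in> \<Omega>"
    proof -
      have "d p s \<in> L \<longleftrightarrow> d p t \<in> L" if "d s t \<in> L" for s t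
        using trans[OF _ that, of p] trans[OF _ sym[OF that], of p] by blast
      then show ?thesis by (simp add: \<Omega>_def)
    qed
    show "(\<lambda>t. w (s + t)) \<in> \<Omega>" if "w \<in> \<Omega>" for w s
      using that unfolding \<Omega>_def by (auto simp: d_def lookup_add)
    show "weighted_sum w g = 0"
      if w: "w \<in> \<Omega>" and g: "g \<in> {monom (pos_part u) - monom (neg_part u) |u. u \<in> L}" for w g
    proof -
      obtain u where u: "u \<in> L" "g = monom (pos_part u) - monom (neg_part u)" using g by blast
      have "d (Abs_poly_mapping (pos_part u)) (Abs_poly_mapping (neg_part u)) = u"
        by (auto simp: d_def pos_part_def neg_part_def)
      then show ?thesis using w u by (simp add: \<Omega>_def monom_def weighted_sum_diff)
    qed
  qed
  moreover have "d p p \<in> L" using L by (simp add: d_def is_lattice_def)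
  ultimately show ?thesis by (simp add: weighted_sum_diff d_def split: if_splits)
qed

section \<open>Supports\<close>

lemma keys_add_nat: "keys (p + q :: 'n \<Rightarrow>\<^sub>0 nat) = keys p \<union> keys q"
  by (auto simp: in_keys_iff lookup_add)

lemma squarefree_keys_subset_divides:
  fixes p q :: "'n \<Rightarrow>\<^sub>0 nat"
  assumes "squarefree_exp (lookup p)" "keys p \<subseteq> keys q"
  shows "\<exists>r. q = p + r"
proof -
  have "lookup p i \<le> lookup q i" for i
    using assms by (cases "lookup p i = 0")
      (auto simp: squarefree_exp_def in_keys_iff subset_iff Suc_le_eq intro: order_trans)
  then have "q = p + (q - p)"
    by (intro poly_mapping_eqI) (simp add: lookup_add lookup_minus)
  then show ?thesis ..
qed

text \<open>For a multiplicative weight the functional is a ring homomorphism to the field; powers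
  of binomials are all that is needed.\<close>

lemma weighted_sum_binomial_power:
  fixes w :: "('n \<Rightarrow>\<^sub>0 nat) \<Rightarrow> 'k::field"
  assumes "\<And>s t. w (s + t) = w s * w t" "w 0 = 1"
  shows "weighted_sum w ((mon p - mon q :: ('n, 'k) mpoly) ^ n) = (w p - w q) ^ n"
proof (induction n)
  case 0
  then show ?case using weighted_sum_single[of w 0 1] assms(2) by simp
next
  case (Suc n)
  have scale: "weighted_sum (\<lambda>t. c * w t) f = c * weighted_sum w f" for c f
    by (simp add: weighted_sum_def sum_distrib_left algebra_simps)
  show ?case
    by (simp add: left_diff_distrib weighted_sum_diff weighted_sum_single_mult assms(1) scale Suc)
qed

text \<open>The indicator of \<open>keys t \<subseteq> \<sigma>\<close> is multiplicative; its
  functional evaluates at the point with coordinates 1 on \<open>\<sigma>\<close> and 0 elsewhere.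
  If no term of \<open>C\<close> were supported in \<open>\<sigma>\<close>, all of \<open>C\<close>
  would vanish there, while the binomial has value 1 or -1.\<close>

lemma key_supported_in_of_power_mem:
  fixes C :: "('n, 'k::field) mpoly set"
  assumes mem: "(mon p - mon q) ^ n \<in> gen_ideal C"
    and supp: "(keys p \<subseteq> \<sigma>) \<noteq> (keys q \<subseteq> \<sigma>)"
  shows "\<exists>g\<in>C. \<exists>c\<in>keys g. keys c \<subseteq> \<sigma>"
proof (rule ccontr)
  assume none: "\<not> ?thesis"
  define w :: "('n \<Rightarrow>\<^sub>0 nat) \<Rightarrow> 'k" where "w t = of_bool (keys t \<subseteq> \<sigma>)" for t
  have w_add: "w (s + t) = w s * w t" for s t
    by (simp add: w_def keys_add_nat)
  \<comment> \<open>Shifting \<open>w\<close> by \<open>s\<close> multiplies it by the scalar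
    \<open>w s\<close>, so the scalar multiples of \<open>w\<close> are closed under shifts.\<close>
  define \<Omega> where "\<Omega> = range (\<lambda>k t. k * w t)"
  have "weighted_sum (\<lambda>t. 1 * w t) ((mon p - mon q) ^ n) = 0"
  proof (rule weighted_sum_gen_ideal_eq_0[OF mem, of _ \<Omega>])
    show "(\<lambda>t. 1 * w t) \<in> \<Omega>" unfolding \<Omega>_def by (rule rangeI)
    show "(\<lambda>t. v (s + t)) \<in> \<Omega>" if "v \<in> \<Omega>" for v s
    proof -
      obtain k where "v = (\<lambda>t. k * w t)" using \<open>v \<in> \<Omega>\<close> by (auto simp: \<Omega>_def)
      then have "(\<lambda>t. v (s + t)) = (\<lambda>t. (k * w s) * w t)" by (simp add: w_add mult.assoc)
      then show ?thesis unfolding \<Omega>_def by (rule range_eqI)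
    qed
    show "weighted_sum v g = 0" if "v \<in> \<Omega>" "g \<in> C" for v g
      using that none by (auto simp: \<Omega>_def weighted_sum_def w_def intro!: sum.neutral)
  qed
  then have "(w p - w q) ^ n = 0"
    using weighted_sum_binomial_power[of w p q n, OF w_add] by (simp add: w_def[of 0])
  then show False using supp by (auto simp: w_def of_bool_def split: if_splits)
qed

section \<open>Ideals with a unique minimal system of binomial generators\<close>

text \<open>Between distinct generators, divisibility permits an exchange that violates uniqueness.
  Within one generator, it would give a nonzero nonnegative vector of \<open>L\<close>.\<close>

lemma minimal_binomial_gen_exponents_incomparable:
  fixes L :: "('n::finite \<Rightarrow> int) set" and S :: "('n, 'k::field) mpoly set"
  assumes L: "is_lattice L" "\<forall>u\<in>L. (\<forall>i. u i \<ge> 0) \<longrightarrow> u = (\<lambda>i. 0)"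
    and uniq: "unique_minimal_binomial_gens (lattice_ideal L :: ('n, 'k) mpoly set)"
    and S: "minimal_binomial_gen_set (lattice_ideal L) S" "finite S"
    and B: "B \<in> S" "p \<in> keys B" and B': "B' \<in> S" "p' \<in> keys B'"
    and div: "p = p' + r"
  shows "B = B' \<and> p = p'"
proof -
  let ?I = "lattice_ideal L :: ('n, 'k) mpoly set"
  have bin: "\<forall>f\<in>S. is_binomial f" and gen: "gen_ideal S = ?I"
    and min: "\<And>T. T \<subset> S \<Longrightarrow> gen_ideal T \<noteq> ?I"
    using S(1) unfolding minimal_binomial_gen_set_def by blast+
  have idI: "is_ideal ?I" using gen is_ideal_gen_ideal by metis
  have SI: "S \<subseteq> ?I" using gen gen_ideal_superset by blast
  obtain q where q: "B = mon p - mon q \<or> B = - (mon p - mon q)" "p \<noteq> q" "keys B = {p, q}"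
    by (rule binomial_keyE[OF bin[rule_format, OF B(1)] B(2)])
  obtain q' where q': "B' = mon p' - mon q' \<or> B' = - (mon p' - mon q')" "p' \<noteq> q'"
    "keys B' = {p', q'}"
    by (rule binomial_keyE[OF bin[rule_format, OF B'(1)] B'(2)])
  have mem_iff: "B \<in> J \<longleftrightarrow> mon p - mon q \<in> J" if "is_ideal J" for J
    using q(1) is_ideal_uminus_iff[OF that] by metis
  have mem_iff': "B' \<in> J \<longleftrightarrow> mon p' - mon q' \<in> J" if "is_ideal J" for J
    using q'(1) is_ideal_uminus_iff[OF that] by metis
  have B_notin: "B \<notin> gen_ideal (S - {B})"
  proof
    assume "B \<in> gen_ideal (S - {B})"
    then have "S \<subseteq> gen_ideal (S - {B})" using gen_ideal_superset[of "S - {B}"] by blast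
    then have "?I \<subseteq> gen_ideal (S - {B})" using gen gen_ideal_least is_ideal_gen_ideal by metis
    moreover have "gen_ideal (S - {B}) \<subseteq> ?I" using gen gen_ideal_mono[of "S - {B}" S] by blast
    ultimately show False using min[of "S - {B}"] B(1) by blast
  qed
  have "B = B'"
  proof (rule ccontr)
    assume ne: "B \<noteq> B'"
    \<comment> \<open>Up to sign, \<open>D\<close> is \<open>B\<close> minus a multiple of
      \<open>B'\<close>; since \<open>B'\<close> remains, replacing \<open>B\<close> by
      \<open>D\<close> preserves the ideal.\<close>
    define D where "D = (mon (q' + r) - mon q :: ('n, 'k) mpoly)"
    have D: "D = (mon p - mon q) - mon r * (mon p' - mon q')"
      by (simp add: D_def div mon_add algebra_simps)
    define T where "T = insert D (S - {B})"
    have "D \<in> ?I"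
      unfolding D using mem_iff[OF idI] mem_iff'[OF idI] B(1) B'(1) SI idI
      by (meson is_ideal_diff is_ideal_mult subsetD)
    then have TI: "gen_ideal T \<subseteq> ?I"
      using SI idI by (intro gen_ideal_least) (auto simp: T_def)
    have "B \<in> gen_ideal T"
    proof -
      have idT: "is_ideal (gen_ideal T)" by (rule is_ideal_gen_ideal)
      have "D \<in> gen_ideal T" "B' \<in> gen_ideal T"
        using gen_ideal_superset[of T] ne B'(1) by (auto simp: T_def)
      then have "D + mon r * (mon p' - mon q') \<in> gen_ideal T"
        using mem_iff'[OF idT] idT by (meson is_ideal_add is_ideal_mult)
      then show ?thesis using mem_iff[OF idT] by (simp add: D)
    qed
    then have "S \<subseteq> gen_ideal T" using gen_ideal_superset[of T] by (auto simp: T_def)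
    then have genT: "gen_ideal T = ?I"
      using TI gen gen_ideal_least[OF is_ideal_gen_ideal] by (metis subset_antisym)
    have binT: "\<forall>f\<in>T. is_binomial f" using bin by (auto simp: T_def D_def is_binomial_iff_mon)
    have "finite T" using S(2) by (simp add: T_def)
    \<comment> \<open>\<open>T\<close> itself may be redundant, so uniqueness is applied to a
      minimal subset; it still puts \<open>B\<close> or \<open>- B\<close> into
      \<open>T\<close>.\<close>
    then obtain T' where T': "T' \<subseteq> T" "minimal_binomial_gen_set ?I T'"
      using minimal_binomial_gen_subset_exists[OF _ binT genT] by blast
    then have "(\<lambda>f. {f, - f}) ` S = (\<lambda>f. {f, - f}) ` T'"
      using uniq S(1) unfolding unique_minimal_binomial_gens_def by blast
    then have "{B, - B} \<in> (\<lambda>f. {f, - f}) ` T'" using B(1) by blast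
    then obtain f where f: "f \<in> T" "f = B \<or> f = - B" using T'(1) by (auto simp: doubleton_eq_iff)
    show False
    proof (cases "f = D")
      case True
      then have "keys D = {p, q}" using f(2) q(3) by (metis keys_minus)
      moreover have "keys D \<subseteq> {q' + r, q}" unfolding D_def by (rule keys_mon_diff_subset)
      ultimately have "p = q' + r" using q(2) by auto
      then show False using div q'(2) by simp
    next
      \<comment> \<open>Here \<open>B\<close>, up to sign, already lies among the other generators,
        contradicting minimality.\<close>
      case False
      then have "f \<in> S - {B}" using f(1) by (simp add: T_def)
      then have "f \<in> gen_ideal (S - {B})" by (rule subsetD[OF gen_ideal_superset])
      then have "B \<in> gen_ideal (S - {B})"
        using f(2) is_ideal_uminus_iff[OF is_ideal_gen_ideal] by auto
      then show False using B_notin by blast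
    qed
  qed
  moreover have "p = p'"
  proof (rule ccontr)
    assume "p \<noteq> p'"
    \<comment> \<open>\<open>p'\<close> is an exponent of \<open>B\<close> other than
      \<open>p\<close>, hence it is \<open>q\<close>. So \<open>p - q = r\<close> is a nonnegative
      vector in \<open>L\<close>.\<close>
    then have "p = q + r" using \<open>B = B'\<close> q(3) B'(2) div by auto
    moreover have "mon p - mon q \<in> ?I" using mem_iff[OF idI] B(1) SI by blast
    then have "(\<lambda>i. int (lookup p i) - int (lookup q i)) \<in> L" by (rule lattice_ideal_mon_diff[OF L(1)])
    ultimately have "(\<lambda>i. int (lookup r i)) \<in> L" by (simp add: lookup_add)
    then have "(\<lambda>i. int (lookup r i)) = (\<lambda>i. 0)" using L(2) by simp
    then have "r = 0" by (intro poly_mapping_eqI) (simp add: fun_eq_iff)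
    then show False using \<open>p = q + r\<close> q(2) by simp
  qed
  ultimately show ?thesis by blast
qed

section \<open>Counting exponents by their supports\<close>

lemma minimal_binomial_gens_card_le:
  fixes L :: "('n::finite \<Rightarrow> int) set" and S C :: "('n, 'k::field) mpoly set"
  assumes L: "is_lattice L" "\<forall>u\<in>L. (\<forall>i. u i \<ge> 0) \<longrightarrow> u = (\<lambda>i. 0)"
    and uniq: "unique_minimal_binomial_gens (lattice_ideal L :: ('n, 'k) mpoly set)"
    and S: "minimal_binomial_gen_set (lattice_ideal L) S" "finite S"
    and sqf: "\<And>B p. B \<in> S \<Longrightarrow> p \<in> keys B \<Longrightarrow> squarefree_exp (lookup p)"
    and C: "finite C" "\<forall>g\<in>C. is_binomial g \<and> g \<in> lattice_ideal L"
    and rad: "rad (lattice_ideal L) = rad (gen_ideal C)"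
  shows "card S \<le> card C"
proof -
  let ?I = "lattice_ideal L :: ('n, 'k) mpoly set"
  have bin: "\<forall>f\<in>S. is_binomial f" and gen: "gen_ideal S = ?I"
    and min: "\<And>T. T \<subset> S \<Longrightarrow> gen_ideal T \<noteq> ?I"
    using S(1) unfolding minimal_binomial_gen_set_def by blast+
  note incomp = minimal_binomial_gen_exponents_incomparable[OF L uniq S]
  have SI: "S \<subseteq> ?I" using gen gen_ideal_superset by blast
  \<comment> \<open>\<open>is_binomial\<close> admits 0; minimality excludes it, so each generator
    has exactly two terms.\<close>
  have nonzero: "0 \<notin> S"
  proof
    assume "0 \<in> S"
    moreover have "0 \<in> gen_ideal (S - {0})" using is_ideal_gen_ideal unfolding is_ideal_def by blast
    ultimately have "S \<subseteq> gen_ideal (S - {0})" using gen_ideal_superset[of "S - {0}"] by blast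
    then have "?I \<subseteq> gen_ideal (S - {0})" using gen gen_ideal_least is_ideal_gen_ideal by metis
    moreover have "gen_ideal (S - {0}) \<subseteq> ?I" using gen gen_ideal_mono[of "S - {0}" S] by blast
    ultimately show False using min[of "S - {0}"] \<open>0 \<in> S\<close> by blast
  qed
  define V where "V = \<Union>(keys ` S)"
  define W where "W = \<Union>(keys ` C)"
  have card_keys: "card (keys B) = 2" if B: "B \<in> S" for B
  proof -
    have "keys B \<noteq> {}" using B nonzero by auto
    then obtain p where "p \<in> keys B" by blast
    then obtain q where "p \<noteq> q" "keys B = {p, q}"
      by (rule binomial_keyE[OF bin[rule_format, OF B]])
    then show ?thesis by simp
  qed
  have "card V = (\<Sum>B\<in>S. card (keys B))"
    unfolding V_def
  proof (rule card_UN_disjoint)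
    have "B = B'" if "B \<in> S" "B' \<in> S" "p \<in> keys B" "p \<in> keys B'" for B B' p
      using incomp[OF that(1,3,2,4), of 0] by simp
    then show "\<forall>B\<in>S. \<forall>B'\<in>S. B \<noteq> B' \<longrightarrow> keys B \<inter> keys B' = {}" by blast
  qed (use S(2) in auto)
  then have card_V: "card V = 2 * card S" using card_keys by simp
  have "card W \<le> (\<Sum>g\<in>C. card (keys g))"
    unfolding W_def using C(1) by (rule card_UN_le)
  also have "\<dots> \<le> (\<Sum>g\<in>C. 2)" using C(2) card_keys_binomial_le by (intro sum_mono) blast
  finally have card_W: "card W \<le> 2 * card C" by simp
  have "\<exists>c\<in>W. keys c = keys p" if p: "p \<in> V" for p
  proof -
    obtain B where B: "B \<in> S" "p \<in> keys B" using p by (auto simp: V_def)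
    obtain q where q: "B = mon p - mon q \<or> B = - (mon p - mon q)" "p \<noteq> q" "keys B = {p, q}"
      by (rule binomial_keyE[OF bin[rule_format, OF B(1)] B(2)])
    \<comment> \<open>This separates the two terms of \<open>B\<close>: at the point given by the
      support of \<open>p\<close>, the first is 1 and the second 0.\<close>
    have "\<not> keys q \<subseteq> keys p"
    proof
      assume "keys q \<subseteq> keys p"
      then obtain r where "p = q + r"
        using squarefree_keys_subset_divides sqf[OF B(1), of q] q(3) by blast
      then show False using incomp[OF B B(1), of q r] q by auto
    qed
    moreover have "B ^ 1 \<in> ?I" using B(1) SI by auto
    then have "B \<in> rad ?I" unfolding rad_def by blast
    then obtain n where n: "B ^ n \<in> gen_ideal C" using rad unfolding rad_def by blast
    have "B = mon p - mon q \<or> B = mon q - mon p" using q(1) by auto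
    ultimately have "\<exists>g\<in>C. \<exists>c\<in>keys g. keys c \<subseteq> keys p"
      using n key_supported_in_of_power_mem[of p q n C "keys p"]
        key_supported_in_of_power_mem[of q p n C "keys p"] by auto
    then obtain g c where c: "g \<in> C" "c \<in> keys g" "keys c \<subseteq> keys p" by blast
    then have "g \<in> gen_ideal S" using C(2) gen by simp
    \<comment> \<open>The supports are nested as \<open>p'\<close>, \<open>c\<close>,
      \<open>p\<close>; squarefreeness makes \<open>p'\<close> divide \<open>p\<close>, and
      incomparability collapses the chain.\<close>
    then obtain p' r B' where p': "B' \<in> S" "p' \<in> keys B'" "c = p' + r"
      using key_of_gen_ideal_divisible c(2) by blast
    then have sub: "keys p' \<subseteq> keys c" by (simp add: keys_add_nat)
    then obtain r' where "p = p' + r'"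
      using squarefree_keys_subset_divides sqf[OF p'(1,2)] c(3) by blast
    then have "p = p'" using incomp[OF B p'(1,2)] by blast
    then have "keys c = keys p" using sub c(3) by blast
    then show ?thesis using c by (auto simp: W_def)
  qed
  then obtain h where h: "\<And>p. p \<in> V \<Longrightarrow> h p \<in> W \<and> keys (h p) = keys p" by metis
  have "inj_on h V"
  proof (rule inj_onI)
    fix p p' assume pp: "p \<in> V" "p' \<in> V" "h p = h p'"
    then have "keys p' = keys p" using h by metis
    obtain B B' where B: "B \<in> S" "p \<in> keys B" "B' \<in> S" "p' \<in> keys B'" using pp by (auto simp: V_def)
    obtain r where "p = p' + r"
      using squarefree_keys_subset_divides sqf[OF B(3,4)] \<open>keys p' = keys p\<close> by blast
    then show "p = p'" using incomp[OF B] by blast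
  qed
  moreover have "finite W" using C(1) by (simp add: W_def)
  ultimately have "card V \<le> card W" using h by (intro card_inj_on_le[of h]) auto
  then show ?thesis using card_V card_W by linarith
qed

section \<open>The two inequalities between \<open>bar\<close> and \<open>mu\<close>\<close>

theorem theorem2p16:
  fixes L :: "('n::finite \<Rightarrow> int) set"
  assumes "is_lattice L"
    and "L \<noteq> {\<lambda>i. 0}"
    and "\<forall>u\<in>L. (\<forall>i. u i \<ge> 0) \<longrightarrow> u = (\<lambda>i. 0)"
    and "\<exists>G. finite G \<and> gen_ideal G = (lattice_ideal L :: ('n, 'k::field) mpoly set) \<and>
           (\<forall>f\<in>G. \<exists>u v. squarefree_exp u \<and> squarefree_exp v \<and> f = monom u - monom v)"
    and "unique_minimal_binomial_gens (lattice_ideal L :: ('n, 'k) mpoly set)"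
  shows "bar (lattice_ideal L :: ('n, 'k) mpoly set) = mu (lattice_ideal L :: ('n, 'k) mpoly set)"
proof -
  let ?I = "lattice_ideal L :: ('n, 'k) mpoly set"
  obtain G where G: "finite G" "gen_ideal G = ?I"
    "\<And>f. f \<in> G \<Longrightarrow> \<exists>u v. squarefree_exp u \<and> squarefree_exp v \<and> f = monom u - monom v"
    using assms(4) by blast
  have "\<forall>f\<in>G. is_binomial f" using G(3) unfolding is_binomial_def by blast
  then obtain S\<^sub>0 where S\<^sub>0: "S\<^sub>0 \<subseteq> G" "minimal_binomial_gen_set ?I S\<^sub>0"
    using minimal_binomial_gen_subset_exists[OF G(1) _ G(2)] by blast
  \<comment> \<open>One finite witness ensures that the value chosen by \<open>SOME\<close> in
    \<open>mu\<close> is attained, though perhaps by a set other than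
    \<open>S\<^sub>0\<close>.\<close>
  then have "\<exists>n S. minimal_binomial_gen_set ?I S \<and> finite S \<and> card S = n"
    using G(1) finite_subset by blast
  then have "\<exists>S. minimal_binomial_gen_set ?I S \<and> finite S \<and> card S = mu ?I"
    unfolding mu_def by (rule someI_ex)
  then obtain S where S: "minimal_binomial_gen_set ?I S" "finite S" "card S = mu ?I" by blast
  \<comment> \<open>\<open>S\<close> need not lie in \<open>G\<close>, but uniqueness matches it up
    to sign with \<open>S\<^sub>0\<close>, and signs do not affect exponents.\<close>
  have sqf: "squarefree_exp (lookup p)" if B: "B \<in> S" "p \<in> keys B" for B p
  proof -
    have "(\<lambda>f. {f, - f}) ` S = (\<lambda>f. {f, - f}) ` S\<^sub>0"
      using assms(5) S(1) S\<^sub>0(2) unfolding unique_minimal_binomial_gens_def by blast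
    then have "{B, - B} \<in> (\<lambda>f. {f, - f}) ` S\<^sub>0" using B(1) by blast
    then obtain f where f: "f \<in> S\<^sub>0" "B = f \<or> B = - f" by (auto simp: doubleton_eq_iff)
    then obtain u v where uv: "squarefree_exp u" "squarefree_exp v" "f = monom u - monom v"
      using G(3) S\<^sub>0(1) by blast
    have "p \<in> keys f" using f(2) B(2) by (metis keys_minus)
    then have "p = Abs_poly_mapping u \<or> p = Abs_poly_mapping v"
      unfolding uv(3) monom_def using keys_mon_diff_subset by blast
    then show ?thesis using uv by auto
  qed
  have "bar ?I = card S"
    unfolding bar_def
  proof (rule Least_equality)
    obtain b where "bij_betw b {0..<card S} S" using ex_bij_betw_nat_finite[OF S(2)] by blast
    then have b: "b ` {..<card S} = S" by (simp add: bij_betw_def atLeast0LessThan)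
    have "gen_ideal S = ?I" "\<forall>f\<in>S. is_binomial f"
      using S(1) unfolding minimal_binomial_gen_set_def by blast+
    moreover from this have "S \<subseteq> ?I" using gen_ideal_superset by blast
    ultimately show "\<exists>B. (\<forall>i<card S. is_binomial (B i) \<and> B i \<in> ?I) \<and>
        rad ?I = rad (gen_ideal (B ` {..<card S}))"
      using b by (intro exI[of _ b]) auto
  next
    fix s :: nat
    assume "\<exists>B. (\<forall>i<s. is_binomial (B i) \<and> B i \<in> ?I) \<and> rad ?I = rad (gen_ideal (B ` {..<s}))"
    then obtain B where B: "\<forall>i<s. is_binomial (B i) \<and> B i \<in> ?I"
      "rad ?I = rad (gen_ideal (B ` {..<s}))" by blast
    \<comment> \<open>The family \<open>B\<close> may repeat binomials, so the bound is applied to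
      its image.\<close>
    have "card S \<le> card (B ` {..<s})"
      by (rule minimal_binomial_gens_card_le[OF assms(1,3,5) S(1,2) sqf]) (use B in auto)
    also have "\<dots> \<le> s" using card_image_le[of "{..<s}" B] by simp
    finally show "card S \<le> s" .
  qed
  then show ?thesis using S(3) by simp
qed

end
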